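(* For a fixed prime $p$, positive integer $s$, integer $n'\ge0$ and integer vector ${\boldsymbol b}=(b_1,\dots,b_s)\ne{\boldsymbol 0}$ with $b_1\ge\cdots\ge b_s\ge0$, $$\lim_{m\to\infty}f(p,s,m,n',{\boldsymbol b})=p^{-\sum_{i=1}^{s}(n'+b_i)b_i}\cdot\frac{C_p}{[p,n'+b_s][p,b_s]\prod_{i=2}^{s}[p,b_{i-1}-b_i]}.$$
   Context: $[p,0]=1$, $[p,\ell]=\prod_{j=1}^{\ell}(1-p^{-j})$ for $\ell\ge1$, and $C_p=\prod_{j=1}^{\infty}(1-p^{-j})$. For integers $m\ge b_1$, $m\ge1$, and with $b_0=m$, $$f(p,s,m,n',{\boldsymbol b})=p^{-\sum_{i=1}^{s}(n'+b_i)b_i}\cdot\frac{[p,n'+m][p,m]}{[p,n'+b_s][p,b_s]\prod_{i=1}^{s}[p,b_{i-1}-b_i]}.$$ *)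

theory Defs
  imports "HOL-Analysis.Infinite_Products" "HOL-Computational_Algebra.Primes"
begin

definition pbracket :: "nat \<Rightarrow> nat \<Rightarrow> real" where
  "pbracket p l = (\<Prod>j=1..l. 1 - real p powi (- int j))"

text \<open>Library infinite products are indexed from 0, hence the shift of the index.\<close>
definition C :: "nat \<Rightarrow> real" where
  "C p = (\<Prod>j. 1 - real p powi (- int (Suc j)))"

text \<open>A vector \<open>(b\<^sub>1, \<dots>, b\<^sub>s)\<close> of nonnegative integers is represented by a function of which
  only the values at \<open>1, \<dots>, s\<close> matter.  The update \<open>b(0 := m)\<close> implements the
  convention \<open>b\<^sub>0 = m\<close>.  The truncated differences agree with the integer ones
  whenever \<open>m \<ge> b\<^sub>1 \<ge> \<dots> \<ge> b\<^sub>s\<close>, the range for which \<open>f\<close> is intended.\<close>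
definition f :: "nat \<Rightarrow> nat \<Rightarrow> nat \<Rightarrow> nat \<Rightarrow> (nat \<Rightarrow> nat) \<Rightarrow> real" where
  "f p s m n' b =
     real p powi (- int (\<Sum>i=1..s. (n' + b i) * b i)) *
     (pbracket p (n' + m) * pbracket p m /
       (pbracket p (n' + b s) * pbracket p (b s) *
         (\<Prod>i=1..s. pbracket p ((b(0 := m)) (i - 1) - (b(0 := m)) i))))"

end

theory Submission
  imports Defs
begin

text \<open>Put \<open>C\<^sub>p = lim\<^sub>l [p,l]\<close>. The parameter \<open>m\<close> enters \<open>f\<close> only through the
  three brackets \<open>[p,n'+m]\<close>, \<open>[p,m]\<close> and, as the first factor of the product, \<open>[p,m-b\<^sub>1]\<close>. Each
  of their indices goes to infinity with \<open>m\<close>, so that together they contribute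
  \<open>C\<^sub>p \<cdot> C\<^sub>p / C\<^sub>p = C\<^sub>p\<close>. The quotient of limits is legitimate because \<open>C\<^sub>p \<noteq> 0\<close>: the product
  defining it has nonzero factors and converges absolutely, the series \<open>\<Sum>\<^sub>j p\<^sup>-\<^sup>j\<close> being geometric.\<close>

lemma convergent_prod_one_minus_powi:
  fixes p :: nat
  assumes "p > 1"
  shows "convergent_prod (\<lambda>j. 1 - real p powi (- int (Suc j)))"
proof -
  have "summable (\<lambda>j. (1 / real p) ^ Suc j)"
    using assms by (subst summable_Suc_iff) (auto intro: summable_geometric)
  then have "summable (\<lambda>j. norm (- (real p powi (- int (Suc j)))))"
    by (simp add: power_int_minus divide_simps power_one_over del: of_nat_Suc power_Suc)
  then have "abs_convergent_prod (\<lambda>j. 1 + (- (real p powi (- int (Suc j)))))"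
    by (intro summable_imp_abs_convergent_prod) simp
  then show ?thesis
    by (simp add: abs_convergent_prod_imp_convergent_prod)
qed

lemma one_minus_powi_nonzero:
  fixes p j :: nat
  assumes "p > 1" "j > 0"
  shows "1 - real p powi (- int j) \<noteq> 0"
proof -
  have "real p ^ j > 1"
    using assms by (intro one_less_power) auto
  then show ?thesis
    by (simp add: power_int_minus)
qed

lemma C_nonzero:
  assumes "p > 1"
  shows "C p \<noteq> 0"
  unfolding C_def
  using assms
  by (intro prodinf_nonzero convergent_prod_one_minus_powi one_minus_powi_nonzero) auto

lemma pbracket_tendsto_C:
  assumes "p > 1"
  shows "pbracket p \<longlonglongrightarrow> C p"
proof -
  have "(\<Prod>j\<le>l. 1 - real p powi (- int (Suc j))) = pbracket p (Suc l)" for l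
    unfolding pbracket_def
    by (rule prod.reindex_bij_witness[of _ "\<lambda>j. j - 1" Suc]) auto
  then have "(\<lambda>l. pbracket p (Suc l)) \<longlonglongrightarrow> C p"
    using convergent_prod_LIMSEQ[OF convergent_prod_one_minus_powi[OF assms]]
    by (simp add: C_def)
  then show ?thesis
    by (rule LIMSEQ_imp_Suc)
qed

theorem theorem5p10:
  fixes p s n' :: nat and b :: "nat \<Rightarrow> nat"
  assumes "prime p"
    and "s \<ge> 1"
    and "\<And>i. 1 \<le> i \<Longrightarrow> i < s \<Longrightarrow> b i \<ge> b (i + 1)"
    and "\<exists>i\<in>{1..s}. b i \<noteq> 0"
  shows "(\<lambda>m. f p s m n' b) \<longlonglongrightarrow>
     real p powi (- int (\<Sum>i=1..s. (n' + b i) * b i)) *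
     (C p / (pbracket p (n' + b s) * pbracket p (b s) *
        (\<Prod>i=2..s. pbracket p (b (i - 1) - b i))))"
proof -
  have p: "p > 1"
    using assms(1) by (rule prime_gt_1_nat)
  define w where "w = real p powi (- int (\<Sum>i=1..s. (n' + b i) * b i))"
  define D where "D = pbracket p (n' + b s) * pbracket p (b s)"
  define P where "P = (\<Prod>i=2..s. pbracket p (b (i - 1) - b i))"
  \<comment> \<open>The factor at \<open>i = 1\<close> is the only one that sees \<open>b\<^sub>0 = m\<close>.\<close>
  have split_first: "(\<Prod>i=1..s. pbracket p ((b(0 := m)) (i - 1) - (b(0 := m)) i))
      = pbracket p (m - b 1) * P" for m
  proof -
    have "{1..s} = insert 1 {2..s}"
      using assms(2) by auto
    then show ?thesis
      by (auto simp: P_def intro!: prod.cong)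
  qed
  have f_eq: "f p s m n' b = w / (D * P) *
      (pbracket p (n' + m) * pbracket p m / pbracket p (m - b 1))" for m
    unfolding f_def split_first w_def D_def by simp
  have lim: "(\<lambda>m. pbracket p (g m)) \<longlonglongrightarrow> C p" if "filterlim g sequentially sequentially" for g
    using pbracket_tendsto_C[OF p] that by (rule filterlim_compose)
  have "filterlim (\<lambda>m. n' + m) sequentially sequentially"
    using filterlim_add_const_nat_at_top[of n'] by (simp add: add.commute)
  moreover have "filterlim (\<lambda>m. m - b 1) sequentially sequentially"
    by (rule filterlim_minus_const_nat_at_top)
  ultimately have "(\<lambda>m. pbracket p (n' + m) * pbracket p m / pbracket p (m - b 1))
      \<longlonglongrightarrow> C p * C p / C p"
    by (intro tendsto_divide tendsto_mult lim pbracket_tendsto_C C_nonzero p)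
  then have "(\<lambda>m. f p s m n' b) \<longlonglongrightarrow> w / (D * P) * (C p * C p / C p)"
    unfolding f_eq by (rule tendsto_mult_left)
  then show ?thesis
    using C_nonzero[OF p] by (simp add: w_def D_def P_def)
qed

end
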